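(* Let $\psi:\mathbb{R}^d\times\mathbb{R}^d\to\mathbb{R}$ be a positive, bounded, continuous function. Let $x_i^0:[-\tau,0]\to\mathbb{R}^d$ be a continuous function for any $i=1,\dots,N$. Assume that the weight function $\alpha:[0,+\infty)\to[0,1]$ is continuous and satisfies the following condition (WF): there exist $T>0$ and a sequence $\{t_n\}_{n}$ of nonnegative numbers such that $t_0=0$, $t_n\to\infty$ as $n\to\infty$, $$t_n-t_{n-1}\le T\quad\text{for all integers } n\ge 1,$$ and, for some positive constant $\bar\alpha$, $$\int_{t_{n-1}}^{t_n}\alpha(t)\,dt\ge\bar\alpha\quad\text{for all integers } n\ge 1 .$$ Then every solution $\{x_i\}_{i=1,\dots,N}$ of $$\frac{d}{dt}x_i(t)=\sum_{j:\,j\ne i}\alpha(t)b_{ij}(t)\,(x_j(t-\tau)-x_i(t)),\quad t>0,\ i=1,\dots,N,$$ with the initial conditions $x_i(s)=x_i^0(s)$ for $s\in[-\tau,0]$, $i=1,\dots,N$, satisfies the exponential decay estimate $$d(t)\le\Big(\max_{i,j=1,\dots,N}\ \max_{r,s\in[-\tau,0]}|x_i(r)-x_j(s)|\Big)\,e^{-\tilde\gamma(t-3T+\tau)}\qquad\text{for all } t\ge 0,$$ where $T$ is the positive constant in the bound $t_n-t_{n-1}\le T$ above, for a suitable positive constant $\tilde\gamma$ independent of $N$.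
   Context: Here $N\ge 2$ is the number of agents, $x_i(t)\in\mathbb{R}^d$ is the opinion of the $i$-th agent at time $t$, and the constant $\tau>0$ is the time delay. The communication rates are $b_{ij}(t)=\frac{1}{N-1}\psi(x_i(t),x_j(t-\tau))$ for $t>0$ and $i,j=1,\dots,N$. The diameter is $d(t):=\max_{i,j=1,\dots,N}|x_i(t)-x_j(t)|$, where $|\cdot|$ is the usual norm on $\mathbb{R}^d$.
   Formalization: In the exponent, T is replaced by max(T, 2τ) unless all gaps t_n − t_{n−1} are at least τ; with arbitrary T the estimate is false (e.g. 3T < τ, constant unequal initial data, t = 0). The rate γ̃ is uniform in N and in all initial data bounded by a given R. *)

theory Defs
  imports "HOL-Analysis.Analysis"
begin

text \<open>Agents are the numbers \<open>1..N\<close>; a trajectory is \<open>x :: nat \<Rightarrow> real \<Rightarrow> real^'d\<close>, where \<open>x i t\<close> is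
  the opinion of agent \<open>i\<close> at time \<open>t\<close>. Only \<open>i \<in> {1..N}\<close> and \<open>t \<ge> - \<tau>\<close> are relevant.\<close>

definition comm_rate ::
    "((real^'d) \<times> (real^'d) \<Rightarrow> real) \<Rightarrow> real \<Rightarrow> nat \<Rightarrow> (nat \<Rightarrow> real \<Rightarrow> real^'d) \<Rightarrow> nat \<Rightarrow> nat \<Rightarrow> real \<Rightarrow> real"
  where "comm_rate \<psi> \<tau> N x i j t = \<psi> (x i t, x j (t - \<tau>)) / (real N - 1)"

definition opinion_diameter :: "nat \<Rightarrow> (nat \<Rightarrow> real \<Rightarrow> real^'d) \<Rightarrow> real \<Rightarrow> real"
  where "opinion_diameter N x t = Max ((\<lambda>(i, j). norm (x i t - x j t)) ` ({1..N} \<times> {1..N}))"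

text \<open>The inner maximum is written as a supremum; it is attained, since the trajectories are
  continuous on the compact interval \<open>{-\<tau>..0}\<close>.\<close>

definition initial_diameter :: "real \<Rightarrow> nat \<Rightarrow> (nat \<Rightarrow> real \<Rightarrow> real^'d) \<Rightarrow> real"
  where "initial_diameter \<tau> N x =
    Max ((\<lambda>(i, j). SUP (r, s) \<in> {-\<tau>..0} \<times> {-\<tau>..0}. norm (x i r - x j s)) ` ({1..N} \<times> {1..N}))"

text \<open>The condition (WF), with its witnesses \<open>T\<close>, \<open>ts\<close>, \<open>a\<close> exposed. The sequence \<open>ts\<close> is
  automatically increasing: for \<open>ts n < ts (n - 1)\<close> the integral is over an empty interval.\<close>

definition weight_condition :: "(real \<Rightarrow> real) \<Rightarrow> real \<Rightarrow> (nat \<Rightarrow> real) \<Rightarrow> real \<Rightarrow> bool"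
  where "weight_condition \<alpha> T ts a \<longleftrightarrow>
    0 < T \<and> 0 < a \<and> ts 0 = 0 \<and> (\<forall>n. 0 \<le> ts n) \<and> filterlim ts at_top sequentially \<and>
    (\<forall>n\<ge>1. ts n - ts (n - 1) \<le> T) \<and>
    (\<forall>n\<ge>1. a \<le> integral {ts (n - 1)..ts n} \<alpha>)"

definition hk_solution ::
    "((real^'d) \<times> (real^'d) \<Rightarrow> real) \<Rightarrow> (real \<Rightarrow> real) \<Rightarrow> real \<Rightarrow> nat \<Rightarrow>
     (nat \<Rightarrow> real \<Rightarrow> real^'d) \<Rightarrow> (nat \<Rightarrow> real \<Rightarrow> real^'d) \<Rightarrow> bool"
  where "hk_solution \<psi> \<alpha> \<tau> N x0 x \<longleftrightarrow>
    (\<forall>i\<in>{1..N}. continuous_on {-\<tau>..} (x i)) \<and>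
    (\<forall>i\<in>{1..N}. \<forall>s\<in>{-\<tau>..0}. x i s = x0 i s) \<and>
    (\<forall>i\<in>{1..N}. \<forall>t>0. (x i has_vector_derivative
        (\<Sum>j\<in>{1..N} - {i}. (\<alpha> t * comm_rate \<psi> \<tau> N x i j t) *\<^sub>R (x j (t - \<tau>) - x i t))) (at t))"

text \<open>The constant \<open>T\<close> of the decay estimate. An upper bound \<open>T\<close> on the gaps of \<open>ts\<close> may
  always be enlarged, and the exponent \<open>t - 3 * T + \<tau>\<close> requires \<open>T\<close> to be compatible with the
  delay: either the gaps are at least \<open>\<tau>\<close>, or \<open>2 * \<tau> \<le> T\<close>. In both cases \<open>decay_period \<tau> T ts = T\<close>;
  otherwise \<open>T\<close> is replaced by the larger bound \<open>2 * \<tau>\<close>. Without this the estimate fails: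
  for constant, not all equal initial data and \<open>3 * T < \<tau>\<close> it would bound the diameter at
  time \<open>0\<close> by a number smaller than itself.\<close>

definition decay_period :: "real \<Rightarrow> real \<Rightarrow> (nat \<Rightarrow> real) \<Rightarrow> real"
  where "decay_period \<tau> T ts = (if \<forall>n\<ge>1. \<tau> \<le> ts n - ts (n - 1) then T else max T (2 * \<tau>))"

lemma decay_period_eq:
  assumes "(\<forall>n\<ge>1. \<tau> \<le> ts n - ts (n - 1)) \<or> 2 * \<tau> \<le> T"
  shows "decay_period \<tau> T ts = T"
  using assms by (auto simp: decay_period_def)

lemma weight_condition_decay_period:
  assumes "weight_condition \<alpha> T ts a"
  shows "weight_condition \<alpha> (decay_period \<tau> T ts) ts a"
  using assms by (auto simp: weight_condition_def decay_period_def max_def intro: order_trans)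

end

theory Submission
  imports Defs
begin

text \<open>Project all opinions onto a vector \<open>v\<close>; let \<open>M\<close> and \<open>m\<close> be the extreme values of
  the projections \<open>u k\<close> over a delay window, and \<open>\<delta> = M - m\<close>. These bounds persist, and each of \<open>M - u i\<close> and
  \<open>u j - m\<close> decays at most like \<open>exp (- K t)\<close>. For \<open>i \<noteq> j\<close> the sum \<open>W = (M - u i) + (u j - m)\<close> obeys a
  closed delay inequality: in
  \<open>(\<Sum>k\<noteq>i. M - u k) + (\<Sum>k\<noteq>j. u k - m) = N \<delta> - W\<close> (at the delayed time) the individual opinions
  cancel, so dividing by \<open>N - 1\<close> gives a bound independent of \<open>N\<close>. If \<open>W\<close> is at least \<open>\<delta>\<close> at the
  end of the window it stays a definite fraction of \<open>\<delta>\<close> for a bounded time. Otherwise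
  \<open>2 \<delta> - W\<close> stays positive, so one interval on which \<open>\<alpha>\<close> has mass \<open>a\<close>, lying at least \<open>\<tau>\<close> after the
  window, pushes \<open>W\<close> up to such a fraction. In either case the spread over a later window
  is smaller by a fixed factor. By the choice of the decay period such an interval \<open>{ts n..ts (n + 1)}\<close>
  fits into \<open>{\<tau>..3 T - \<tau>}\<close>, which gives the shift in the exponent.\<close>

section \<open>Scalar comparison lemmas\<close>

text \<open>Past the last time \<open>c\<close> with \<open>0 \<le> f c\<close> the function stays
  negative, hence nondecreasing, so \<open>f q\<close> cannot be below \<open>f c\<close>.\<close>

lemma nonneg_if_deriv_nonneg_where_negative:
  fixes f f' :: "real \<Rightarrow> real"
  assumes "p \<le> q" and cont: "continuous_on {p..q} f" and "0 \<le> f p"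
    and der: "\<And>t. p < t \<Longrightarrow> t < q \<Longrightarrow> (f has_real_derivative f' t) (at t)"
    and neg: "\<And>t. p < t \<Longrightarrow> t < q \<Longrightarrow> f t < 0 \<Longrightarrow> 0 \<le> f' t"
  shows "0 \<le> f q"
proof (rule ccontr)
  assume "\<not> 0 \<le> f q"
  define S where "S = {t \<in> {p..q}. 0 \<le> f t}"
  define c where "c = Sup S"
  have "closed S"
    using continuous_on_closed_Collect_le[OF continuous_on_const cont, of 0]
    by (simp add: S_def)
  moreover have "p \<in> S" using assms by (auto simp: S_def)
  moreover have bdd: "bdd_above S" by (auto simp: S_def intro: bdd_aboveI[of _ q])
  ultimately have "c \<in> S" unfolding c_def by (intro closed_contains_Sup) auto
  then have c: "p \<le> c" "c \<le> q" "0 \<le> f c" by (auto simp: S_def)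
  have "f t < 0" if "c < t" "t \<le> q" for t
  proof (rule ccontr)
    assume "\<not> f t < 0"
    then have "t \<in> S" using that c by (auto simp: S_def)
    then have "t \<le> c" unfolding c_def using bdd by (intro cSup_upper)
    then show False using that by simp
  qed
  then have "\<exists>y. (f has_real_derivative y) (at t) \<and> 0 \<le> y" if "c < t" "t < q" for t
    using der[of t] neg[of t] c that by auto
  then have "f c \<le> f q"
    using c(1,2) continuous_on_subset[OF cont, of "{c..q}"]
    by (auto intro: DERIV_nonneg_imp_increasing_open[of c q f])
  then show False using c \<open>\<not> 0 \<le> f q\<close> by simp
qed

text \<open>Integrating factor: \<open>exp (K * A t) * (f t - C / K)\<close> is nondecreasing.
  \<open>A\<close> acts as a clock: time itself in one use, the accumulated mass of
  \<open>\<alpha>\<close> in the other.\<close>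

lemma linear_differential_inequality:
  fixes f A g :: "real \<Rightarrow> real"
  assumes "p \<le> q" and "0 < K"
    and contf: "continuous_on {p..q} f" and contA: "continuous_on {p..q} A"
    and derA: "\<And>t. p < t \<Longrightarrow> t < q \<Longrightarrow> (A has_real_derivative g t) (at t)"
    and derf: "\<And>t. p < t \<Longrightarrow> t < q \<Longrightarrow>
      \<exists>D. (f has_real_derivative D) (at t) \<and> g t * (C - K * f t) \<le> D"
  shows "C / K + exp (- K * (A q - A p)) * (f p - C / K) \<le> f q"
proof -
  define F where "F = (\<lambda>t. exp (K * A t) * (f t - C / K))"
  have "F p \<le> F q"
  proof (rule DERIV_nonneg_imp_increasing_open[OF \<open>p \<le> q\<close>])
    fix t assume t: "p < t" "t < q"
    then obtain D where D: "(f has_real_derivative D) (at t)" "g t * (C - K * f t) \<le> D"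
      using derf by blast
    have "(F has_real_derivative exp (K * A t) * (D - g t * (C - K * f t))) (at t)"
      unfolding F_def using \<open>0 < K\<close>
      by (auto intro!: derivative_eq_intros D(1) derA t simp: field_simps)
    moreover have "0 \<le> exp (K * A t) * (D - g t * (C - K * f t))"
      using D(2) by simp
    ultimately show "\<exists>y. (F has_real_derivative y) (at t) \<and> 0 \<le> y" by blast
  qed (auto simp: F_def intro!: continuous_intros contf contA)
  then have "exp (- K * A q) * F p \<le> exp (- K * A q) * F q" by simp
  moreover have "exp (- K * A q) * F q = f q - C / K"
    by (simp add: F_def flip: mult.assoc exp_add)
  moreover have "exp (- K * A q) * F p = exp (- K * (A q - A p)) * (f p - C / K)"
    by (simp add: F_def algebra_simps flip: mult.assoc exp_add)
  ultimately show ?thesis by linarith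
qed

text \<open>\<open>(1 - exp (- K * a)) * \<kappa> / K\<close> is what
  \<open>y' = \<alpha> * (\<kappa> - K * y)\<close> reaches from 0 once \<open>\<alpha>\<close> has
  accumulated mass \<open>a\<close>. One factor \<open>exp (- K * H)\<close> weakens the delayed
  input, the other is lost in carrying the gain to later times.\<close>

definition contraction :: "real \<Rightarrow> real \<Rightarrow> real \<Rightarrow> real \<Rightarrow> real" where
  "contraction K \<kappa> H a = (exp (- K * H))\<^sup>2 * ((1 - exp (- K * a)) * \<kappa> / K)"

lemma contraction_bounds:
  assumes "0 < \<kappa>" "\<kappa> \<le> K" "0 < H" "0 < a"
  shows "0 < contraction K \<kappa> H a" and "contraction K \<kappa> H a < 1"
proof -
  have K: "0 < K" using assms by simp
  have e: "(exp (- K * H))\<^sup>2 < 1" using K assms by (simp add: power_less_one_iff abs_less_iff)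
  have c: "0 < (1 - exp (- K * a)) * \<kappa> / K" using K assms by simp
  have "(1 - exp (- K * a)) * \<kappa> \<le> 1 * K" using K assms by (intro mult_mono) auto
  then have "(1 - exp (- K * a)) * \<kappa> / K \<le> 1" using K by simp
  then show "contraction K \<kappa> H a < 1"
    unfolding contraction_def using mult_less_le_imp_less[OF e _ _ c] by fastforce
  show "0 < contraction K \<kappa> H a" unfolding contraction_def using c by (intro mult_pos_pos) auto
qed

section \<open>Delayed averaging of real numbers\<close>

text \<open>The rates \<open>w\<close> are given functions of time, so the system is linear in
  \<open>u\<close>. Allowing \<open>\<kappa> = 0\<close> makes the invariance of bounds available
  before a positive lower bound on the rates is known.\<close>

locale delayed_averaging =
  fixes N :: nat and \<tau> K \<kappa> :: real and \<alpha> :: "real \<Rightarrow> real"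
    and w :: "nat \<Rightarrow> nat \<Rightarrow> real \<Rightarrow> real" and u :: "nat \<Rightarrow> real \<Rightarrow> real"
  assumes N: "2 \<le> N" and tau: "0 < \<tau>" and kappa: "0 \<le> \<kappa>" and K: "0 < K" "\<kappa> \<le> K"
    and alpha: "0 \<le> t \<Longrightarrow> 0 \<le> \<alpha> t" "0 \<le> t \<Longrightarrow> \<alpha> t \<le> 1"
    and alpha_cont: "continuous_on {0..} \<alpha>"
    and cont: "i \<in> {1..N} \<Longrightarrow> continuous_on {-\<tau>..} (u i)"
    and w: "i \<in> {1..N} \<Longrightarrow> j \<in> {1..N} \<Longrightarrow> 0 < t \<Longrightarrow> \<kappa> \<le> w i j t"
      "i \<in> {1..N} \<Longrightarrow> j \<in> {1..N} \<Longrightarrow> 0 < t \<Longrightarrow> w i j t \<le> K"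
    and deriv: "i \<in> {1..N} \<Longrightarrow> 0 < t \<Longrightarrow> (u i has_real_derivative
      \<alpha> t * (\<Sum>j\<in>{1..N} - {i}. w i j t / (real N - 1) * (u j (t - \<tau>) - u i t))) (at t)"
begin

text \<open>By linearity negation preserves the system; results about an upper bound
  \<open>M\<close> yield those about a lower bound \<open>m\<close> through this instance with
  \<open>- m\<close>.\<close>

lemma neg: "delayed_averaging N \<tau> K \<kappa> \<alpha> w (\<lambda>i t. - u i t)"
proof
  fix i t assume "i \<in> {1..N}" "(0::real) < t"
  have "- (\<alpha> t * (\<Sum>j\<in>{1..N} - {i}. w i j t / (real N - 1) * (u j (t - \<tau>) - u i t)))
      = \<alpha> t * (\<Sum>j\<in>{1..N} - {i}. - (w i j t / (real N - 1) * (u j (t - \<tau>) - u i t)))"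
    by (simp only: sum_negf mult_minus_right)
  also have "\<dots> = \<alpha> t * (\<Sum>j\<in>{1..N} - {i}. w i j t / (real N - 1) * (- u j (t - \<tau>) - - u i t))"
    unfolding mult_minus_right[symmetric] by simp
  finally show "((\<lambda>t. - u i t) has_real_derivative
      \<alpha> t * (\<Sum>j\<in>{1..N} - {i}. w i j t / (real N - 1) * (- u j (t - \<tau>) - - u i t))) (at t)"
    using DERIV_minus[OF deriv[OF \<open>i \<in> {1..N}\<close> \<open>0 < t\<close>]] by (simp only:)
qed (rule N tau kappa K alpha_cont | erule alpha | (rule w; assumption)
    | (rule continuous_on_minus, erule cont))+

lemma weight_nonneg:
  "i \<in> {1..N} \<Longrightarrow> j \<in> {1..N} \<Longrightarrow> 0 < t \<Longrightarrow> 0 \<le> w i j t / (real N - 1)"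
  using order_trans[OF kappa w(1)[of i j t]] N by simp

lemma sum_weights_le: "i \<in> {1..N} \<Longrightarrow> 0 < t \<Longrightarrow> (\<Sum>j\<in>{1..N} - {i}. w i j t / (real N - 1)) \<le> K"
proof -
  assume i: "i \<in> {1..N}" "0 < t"
  have "(\<Sum>j\<in>{1..N} - {i}. w i j t / (real N - 1)) \<le> (\<Sum>j\<in>{1..N} - {i}. K / (real N - 1))"
    using i N w by (intro sum_mono divide_right_mono) auto
  also have "\<dots> = K" using i N by (simp add: of_nat_diff)
  finally show ?thesis .
qed

abbreviation gap' :: "real \<Rightarrow> nat \<Rightarrow> real \<Rightarrow> real" where
  "gap' M i t \<equiv> \<alpha> t * ((\<Sum>j\<in>{1..N} - {i}. w i j t / (real N - 1) * (M - u j (t - \<tau>)))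
     - (\<Sum>j\<in>{1..N} - {i}. w i j t / (real N - 1)) * (M - u i t))"

lemma gap_deriv:
  assumes "i \<in> {1..N}" "0 < t"
  shows "((\<lambda>t. M - u i t) has_real_derivative gap' M i t) (at t)"
proof -
  have "(\<Sum>j\<in>{1..N} - {i}. w i j t / (real N - 1) * (u j (t - \<tau>) - u i t))
      = (\<Sum>j\<in>{1..N} - {i}. w i j t / (real N - 1) * (M - u i t)
          - w i j t / (real N - 1) * (M - u j (t - \<tau>)))"
    by (intro sum.cong refl) (simp add: diff_divide_distrib algebra_simps)
  then have "0 - \<alpha> t * (\<Sum>j\<in>{1..N} - {i}. w i j t / (real N - 1) * (u j (t - \<tau>) - u i t)) = gap' M i t"
    by (simp only: sum_subtractf sum_distrib_right right_diff_distrib)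
  then show ?thesis using DERIV_diff[OF DERIV_const deriv[OF assms]] by (simp only:)
qed

lemma gap_cont: "i \<in> {1..N} \<Longrightarrow> 0 \<le> p \<Longrightarrow> continuous_on {p..q} (\<lambda>t. M - u i t)"
  using tau by (intro continuous_intros continuous_on_subset[OF cont]) auto

text \<open>During one further delay the times \<open>t - \<tau>\<close> stay in the window where
  \<open>M\<close> is known to be a bound, so the first sum in \<open>gap'\<close> is nonnegative;
  wherever \<open>M - u i\<close> is negative the damping term pushes it up as well.\<close>

lemma upper_bound_step:
  assumes i: "i \<in> {1..N}" and s: "0 \<le> s"
    and M: "\<And>k r. k \<in> {1..N} \<Longrightarrow> s - \<tau> \<le> r \<Longrightarrow> r \<le> s \<Longrightarrow> u k r \<le> M"
    and r: "s - \<tau> \<le> r" "r \<le> s + \<tau>"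
  shows "u i r \<le> M"
proof (cases "r \<le> s")
  case False
  have "0 \<le> M - u i r"
  proof (rule nonneg_if_deriv_nonneg_where_negative
      [where p = s and q = r and f = "\<lambda>t. M - u i t" and f' = "gap' M i"])
    fix t assume t: "s < t" "t < r"
    show "((\<lambda>t. M - u i t) has_real_derivative gap' M i t) (at t)"
      using t s i by (intro gap_deriv) auto
    assume "M - u i t < 0"
    then have "(\<Sum>j\<in>{1..N} - {i}. w i j t / (real N - 1)) * (M - u i t) \<le> 0"
      using t s i by (intro mult_nonneg_nonpos sum_nonneg weight_nonneg) auto
    moreover have "0 \<le> (\<Sum>j\<in>{1..N} - {i}. w i j t / (real N - 1) * (M - u j (t - \<tau>)))"
      using t s i r M by (intro sum_nonneg mult_nonneg_nonneg weight_nonneg) auto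
    ultimately show "0 \<le> gap' M i t"
      using t s alpha(1)[of t] by (intro mult_nonneg_nonneg) auto
  next
    show "continuous_on {s..r} (\<lambda>t. M - u i t)" using s i by (intro gap_cont) auto
    show "0 \<le> M - u i s" using M[of i s] i tau by simp
  qed (use False in simp)
  then show ?thesis by simp
next
  case True
  then show ?thesis using M i r(1) by blast
qed

text \<open>Method of steps: each use of the one-step bound extends the range by
  \<open>\<tau>\<close>.\<close>

lemma upper_bound:
  assumes s: "0 \<le> s"
    and M: "\<And>k r. k \<in> {1..N} \<Longrightarrow> s - \<tau> \<le> r \<Longrightarrow> r \<le> s \<Longrightarrow> u k r \<le> M"
    and i: "i \<in> {1..N}" and r: "s - \<tau> \<le> r"
  shows "u i r \<le> M"
proof -
  have *: "\<forall>k\<in>{1..N}. \<forall>r. s - \<tau> \<le> r \<longrightarrow> r \<le> s + real n * \<tau> \<longrightarrow> u k r \<le> M" for n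
  proof (induction n)
    case (Suc n)
    show ?case
    proof (intro ballI allI impI)
      fix k r assume k: "k \<in> {1..N}" and r: "s - \<tau> \<le> r" "r \<le> s + real (Suc n) * \<tau>"
      show "u k r \<le> M"
      proof (cases "r \<le> s + real n * \<tau>")
        case False
        have n: "0 \<le> real n * \<tau>" using tau by simp
        have "u k' r' \<le> M" if "k' \<in> {1..N}" "s + real n * \<tau> - \<tau> \<le> r'" "r' \<le> s + real n * \<tau>" for k' r'
        proof -
          have "s - \<tau> \<le> r'" using that n by linarith
          then show ?thesis using Suc that by blast
        qed
        moreover have "r \<le> s + real n * \<tau> + \<tau>" "s + real n * \<tau> - \<tau> \<le> r"
          using False r(2) tau by (auto simp: distrib_right)
        ultimately show ?thesis using s n upper_bound_step[OF k, of "s + real n * \<tau>" M r] by simp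
      next
        case True
        then show ?thesis using Suc k r(1) by blast
      qed
    qed
  next
    case 0
    then show ?case using M by simp
  qed
  obtain n :: nat where "(r - s) / \<tau> < real n" using reals_Archimedean2 by blast
  then have "r \<le> s + real n * \<tau>" using tau by (simp add: field_simps)
  then show ?thesis using * i r by blast
qed

text \<open>The delayed input is nonnegative and is discarded; \<open>\<alpha> \<le> 1\<close> and a
  total rate of at most \<open>K\<close> leave \<open>f' \<ge> - K * f\<close> for the gap
  \<open>f\<close>.\<close>

lemma gap_ge_exp:
  assumes "0 \<le> s"
    and M: "\<And>k r. k \<in> {1..N} \<Longrightarrow> s - \<tau> \<le> r \<Longrightarrow> u k r \<le> M"
    and i: "i \<in> {1..N}" and t: "s \<le> p" "p \<le> q"
  shows "exp (- K * (q - p)) * (M - u i p) \<le> M - u i q"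
proof -
  have "0 / K + exp (- K * (q - p)) * ((M - u i p) - 0 / K) \<le> M - u i q"
  proof (rule linear_differential_inequality
      [where A = "\<lambda>t. t" and g = "\<lambda>_. 1" and f = "\<lambda>t. M - u i t"])
    fix t assume t': "p < t" "t < q"
    have "0 \<le> (\<Sum>j\<in>{1..N} - {i}. w i j t / (real N - 1) * (M - u j (t - \<tau>)))"
      using t t' \<open>0 \<le> s\<close> i M by (intro sum_nonneg mult_nonneg_nonneg weight_nonneg) auto
    then have 1: "0 \<le> \<alpha> t * (\<Sum>j\<in>{1..N} - {i}. w i j t / (real N - 1) * (M - u j (t - \<tau>)))"
      using t t' \<open>0 \<le> s\<close> alpha(1)[of t] by simp
    have g: "0 \<le> M - u i t" using M[OF i, of t] t t' tau by simp
    have S: "(\<Sum>j\<in>{1..N} - {i}. w i j t / (real N - 1)) * (M - u i t) \<le> K * (M - u i t)"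
      using sum_weights_le[OF i, of t] t t' \<open>0 \<le> s\<close> g by (intro mult_right_mono) auto
    have "0 \<le> (\<Sum>j\<in>{1..N} - {i}. w i j t / (real N - 1)) * (M - u i t)"
      using t t' \<open>0 \<le> s\<close> i g by (intro sum_nonneg mult_nonneg_nonneg weight_nonneg) auto
    then have "\<alpha> t * ((\<Sum>j\<in>{1..N} - {i}. w i j t / (real N - 1)) * (M - u i t)) \<le> 1 * (K * (M - u i t))"
      using alpha[of t] t t' \<open>0 \<le> s\<close> by (intro mult_mono[OF _ S]) linarith+
    then have "1 * (0 - K * (M - u i t)) \<le> gap' M i t"
      using 1 by (simp add: right_diff_distrib)
    moreover have "((\<lambda>t. M - u i t) has_real_derivative gap' M i t) (at t)"
      using t' t \<open>0 \<le> s\<close> i by (intro gap_deriv) auto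
    ultimately show "\<exists>D. ((\<lambda>t. M - u i t) has_real_derivative D) (at t) \<and> 1 * (0 - K * (M - u i t)) \<le> D"
      by blast
  next
    show "continuous_on {p..q} (\<lambda>t. M - u i t)" using t \<open>0 \<le> s\<close> i by (intro gap_cont) auto
  qed (use t K DERIV_ident in \<open>auto simp: continuous_on_id\<close>)
  then show ?thesis by simp
qed

text \<open>The sum of delayed gaps is kept whole, and \<open>\<alpha>\<close> as a common factor,
  so that the inequality for \<open>i\<close> can be added to its mirror image for
  \<open>j\<close>.\<close>

lemma gap_deriv_ge:
  assumes "0 \<le> s"
    and M: "\<And>k r. k \<in> {1..N} \<Longrightarrow> s - \<tau> \<le> r \<Longrightarrow> u k r \<le> M"
    and i: "i \<in> {1..N}" and t: "s < t"
  shows "\<exists>D. ((\<lambda>t. M - u i t) has_real_derivative D) (at t) \<and>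
    \<alpha> t * (\<kappa> / (real N - 1) * (\<Sum>k\<in>{1..N} - {i}. M - u k (t - \<tau>)) - K * (M - u i t)) \<le> D"
proof (intro exI conjI)
  show "((\<lambda>t. M - u i t) has_real_derivative gap' M i t) (at t)"
    using assms by (intro gap_deriv) auto
  have "\<kappa> / (real N - 1) * (\<Sum>j\<in>{1..N} - {i}. M - u j (t - \<tau>))
      \<le> (\<Sum>j\<in>{1..N} - {i}. w i j t / (real N - 1) * (M - u j (t - \<tau>)))"
    unfolding sum_distrib_left using t \<open>0 \<le> s\<close> i N w(1) M
    by (intro sum_mono mult_right_mono divide_right_mono) auto
  moreover have "(\<Sum>j\<in>{1..N} - {i}. w i j t / (real N - 1)) * (M - u i t) \<le> K * (M - u i t)"
    using t \<open>0 \<le> s\<close> tau sum_weights_le[OF i, of t] M[OF i, of t] by (intro mult_right_mono) auto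
  ultimately show "\<alpha> t * (\<kappa> / (real N - 1) * (\<Sum>k\<in>{1..N} - {i}. M - u k (t - \<tau>)) - K * (M - u i t))
      \<le> gap' M i t"
    using t \<open>0 \<le> s\<close> alpha(1)[of t] by (intro mult_left_mono) auto
qed

text \<open>The times \<open>r\<close> and \<open>r'\<close> are independent, because the spread
  that has to shrink compares opinions at different times of a delay window.\<close>

lemma spread_contraction:
  assumes s: "0 \<le> s" "s + \<tau> \<le> p" "p \<le> q" "q \<le> h"
    and M: "\<And>k r. k \<in> {1..N} \<Longrightarrow> s - \<tau> \<le> r \<Longrightarrow> r \<le> s \<Longrightarrow> u k r \<le> M"
    and m: "\<And>k r. k \<in> {1..N} \<Longrightarrow> s - \<tau> \<le> r \<Longrightarrow> r \<le> s \<Longrightarrow> m \<le> u k r"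
    and a: "0 < a" "a \<le> integral {p..q} \<alpha>"
    and i: "i \<in> {1..N}" and j: "j \<in> {1..N}"
    and r: "q \<le> r" "r \<le> h" "q \<le> r'" "r' \<le> h"
  shows "u i r - u j r' \<le> (1 - contraction K \<kappa> (h - s) a) * (M - m)"
proof -
  define e c \<delta> where "e = exp (- K * (h - s))" and "c = (1 - exp (- K * a)) * \<kappa> / K" and "\<delta> = M - m"
  define W where "W = (\<lambda>t. (M - u i t) + (u j t - m))"
  have U: "u k t \<le> M" if "k \<in> {1..N}" "s - \<tau> \<le> t" for k t
    using upper_bound[OF s(1) M] that by blast
  have L: "m \<le> u k t" if "k \<in> {1..N}" "s - \<tau> \<le> t" for k t
    using delayed_averaging.upper_bound[OF neg s(1), of "- m" k t] m that by simp
  have e: "0 < e" "e \<le> 1" and \<delta>: "0 \<le> \<delta>" and c: "0 \<le> c" "c \<le> 1"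
    using s K kappa a M[OF i, of s] m[OF i, of s] tau mult_mono[of "1 - exp (- K * a)" 1 \<kappa> K]
    by (auto simp: e_def \<delta>_def c_def)
  have gU: "e * (M - u k t) \<le> M - u k t'" if "k \<in> {1..N}" "s \<le> t" "t \<le> t'" "t' \<le> h" for k t t'
  proof -
    have "e * (M - u k t) \<le> exp (- K * (t' - t)) * (M - u k t)"
      unfolding e_def using that K U[of k t] tau by (intro mult_right_mono) auto
    then show ?thesis using gap_ge_exp[OF s(1) U that(1,2,3)] by simp
  qed
  have gL: "e * (u k t - m) \<le> u k t' - m" if "k \<in> {1..N}" "s \<le> t" "t \<le> t'" "t' \<le> h" for k t t'
  proof -
    have "e * (u k t - m) \<le> exp (- K * (t' - t)) * (u k t - m)"
      unfolding e_def using that K L[of k t] tau by (intro mult_right_mono) auto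
    then show ?thesis
      using delayed_averaging.gap_ge_exp[OF neg s(1), of "- m" k t t'] L that by simp
  qed
  have ec: "e * c * \<delta> \<le> e * \<delta>" "e * \<delta> \<le> \<delta>"
    using e c \<delta> by (auto simp: mult_left_le mult_left_le_one_le mult_right_mono)
  \<comment> \<open>For \<open>i = j\<close> the two gaps add up to \<open>\<delta>\<close> at every
    time.\<close>
  consider "i = j" | "\<delta> \<le> W s" | "i \<noteq> j" "W s < \<delta>" by linarith
  then have "e * c * \<delta> \<le> W q"
  proof cases
    case 1
    then show ?thesis using ec by (simp add: W_def \<delta>_def)
  next
    case 2
    have "e * W s \<le> W q"
      using gU[OF i, of s q] gL[OF j, of s q] s tau by (simp add: W_def distrib_left)
    moreover have "e * \<delta> \<le> e * W s" using 2 e by simp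
    ultimately show ?thesis using ec by linarith
  next
    case 3
    \<comment> \<open>\<open>2 * \<delta> - W\<close> equals \<open>(M - u j) + (u i - m)\<close>,
      the sum with the two agents exchanged; it exceeds \<open>\<delta>\<close> at time
      \<open>s\<close> and therefore keeps at least \<open>e * \<delta>\<close>.\<close>
    have W: "W t \<le> 2 * \<delta> - e * \<delta>" if "s \<le> t" "t \<le> h" for t
    proof -
      have "e * (2 * \<delta> - W s) \<le> 2 * \<delta> - W t"
        using gU[OF j _ that] gL[OF i _ that] by (simp add: W_def \<delta>_def algebra_simps)
      moreover have "e * \<delta> \<le> e * (2 * \<delta> - W s)" using 3 e by simp
      ultimately show ?thesis by linarith
    qed
    have A: "((\<lambda>t. integral {0..t} \<alpha>) has_real_derivative \<alpha> t) (at t)" if "0 < t" for t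
    proof -
      have "((\<lambda>t. integral {0..t} \<alpha>) has_real_derivative \<alpha> t) (at t within {0..t + 1})"
        using that by (intro integral_has_real_derivative continuous_on_subset[OF alpha_cont]) auto
      then show ?thesis using that by (simp add: at_within_Icc_at)
    qed
    have contA: "continuous_on {p..q} (\<lambda>t. integral {0..t} \<alpha>)"
      using s tau by (intro continuous_at_imp_continuous_on ballI DERIV_isCont[OF A]) auto
    have int: "integral {0..p} \<alpha> + integral {p..q} \<alpha> = integral {0..q} \<alpha>"
      using s tau by (intro Henstock_Kurzweil_Integration.integral_combine
        integrable_continuous_real continuous_on_subset[OF alpha_cont]) auto
    \<comment> \<open>The bound on \<open>W (t - \<tau>)\<close> gives \<open>real N * \<delta> - W
      (t - \<tau>) \<ge> (real N - 2) * \<delta> + e * \<delta> \<ge> (real N - 1) * (e *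
      \<delta>)\<close>; division by \<open>real N - 1\<close> leaves this \<open>C\<close>, free of
      \<open>N\<close>.\<close>
    define C where "C = \<kappa> * (e * \<delta>)"
    have "C / K + exp (- K * (integral {0..q} \<alpha> - integral {0..p} \<alpha>)) * (W p - C / K) \<le> W q"
    proof (rule linear_differential_inequality[where g = \<alpha>])
      fix t assume t: "p < t" "t < q"
      obtain D where D: "((\<lambda>t. M - u i t) has_real_derivative D) (at t)"
        "\<alpha> t * (\<kappa> / (real N - 1) * (\<Sum>k\<in>{1..N} - {i}. M - u k (t - \<tau>)) - K * (M - u i t)) \<le> D"
        using gap_deriv_ge[OF s(1) U i, of t] t s tau by auto
      obtain D' where D': "((\<lambda>t. u j t - m) has_real_derivative D') (at t)"
        "\<alpha> t * (\<kappa> / (real N - 1) * (\<Sum>k\<in>{1..N} - {j}. u k (t - \<tau>) - m) - K * (u j t - m)) \<le> D'"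
        using delayed_averaging.gap_deriv_ge[OF neg s(1), of "- m" j t] L j t s tau by auto
      \<comment> \<open>Completing both sums to all agents adds exactly the two terms that form
        \<open>W\<close> at the delayed time; each agent then contributes
        \<open>\<delta>\<close>.\<close>
      have "(\<Sum>k\<in>{1..N} - {i}. M - u k (t - \<tau>)) + (\<Sum>k\<in>{1..N} - {j}. u k (t - \<tau>) - m)
          = (\<Sum>k\<in>{1..N}. (M - u k (t - \<tau>)) + (u k (t - \<tau>) - m)) - W (t - \<tau>)"
        unfolding sum.distrib using i j by (simp add: sum_diff1 W_def)
      also have "(\<Sum>k\<in>{1..N}. (M - u k (t - \<tau>)) + (u k (t - \<tau>) - m)) = real N * \<delta>"
        by (simp add: \<delta>_def)
      finally have sums: "(\<Sum>k\<in>{1..N} - {i}. M - u k (t - \<tau>)) + (\<Sum>k\<in>{1..N} - {j}. u k (t - \<tau>) - m)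
          = real N * \<delta> - W (t - \<tau>)" .
      have "(real N - 2) * (e * \<delta>) \<le> (real N - 2) * \<delta>" using ec N by (intro mult_left_mono) auto
      then have "(real N - 1) * (e * \<delta>) \<le> real N * \<delta> - W (t - \<tau>)"
        using W[of "t - \<tau>"] t s tau by (simp add: algebra_simps)
      then have "\<kappa> / (real N - 1) * ((real N - 1) * (e * \<delta>)) \<le> \<kappa> / (real N - 1) * (real N * \<delta> - W (t - \<tau>))"
        using kappa N by (intro mult_left_mono) auto
      then have "C \<le> \<kappa> / (real N - 1) * (real N * \<delta> - W (t - \<tau>))" using N by (simp add: C_def)
      then have "\<alpha> t * (C - K * W t) \<le> \<alpha> t * (\<kappa> / (real N - 1) * (real N * \<delta> - W (t - \<tau>)) - K * W t)"
        using alpha(1)[of t] t s tau by (intro mult_left_mono) auto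
      also have "\<dots> \<le> D + D'"
        using add_mono[OF D(2) D'(2)] unfolding sums[symmetric] unfolding W_def
        by (simp only: distrib_left right_diff_distrib)
      finally show "\<exists>D. (W has_real_derivative D) (at t) \<and> \<alpha> t * (C - K * W t) \<le> D"
        using DERIV_add[OF D(1) D'(1)] by (auto simp: W_def)
    next
      show "continuous_on {p..q} W" unfolding W_def
        using s tau i j by (intro continuous_intros continuous_on_subset[OF cont]) auto
    qed (use s tau K A contA in auto)
    then have "C / K + exp (- K * integral {p..q} \<alpha>) * (W p - C / K) \<le> W q"
      by (simp flip: int)
    moreover have "0 \<le> exp (- K * integral {p..q} \<alpha>) * W p"
      using U[OF i, of p] L[OF j, of p] s tau by (simp add: W_def)
    moreover have "exp (- K * integral {p..q} \<alpha>) * (C / K) \<le> exp (- K * a) * (C / K)"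
      using a K kappa e \<delta> by (intro mult_right_mono) (auto simp: C_def)
    moreover have "C / K - exp (- K * a) * (C / K) = e * c * \<delta>"
      using K by (simp add: C_def c_def field_simps)
    ultimately show ?thesis by (simp add: right_diff_distrib)
  qed
  \<comment> \<open>The second factor \<open>e\<close> carries the gain at \<open>q\<close> on to
    \<open>r\<close> and \<open>r'\<close>; each gap is followed separately, so these times may
    differ.\<close>
  then have "e * (e * c * \<delta>) \<le> e * W q" using e by simp
  also have "\<dots> \<le> (M - u i r) + (u j r' - m)"
    using gU[OF i _ r(1,2)] gL[OF j _ r(3,4)] s tau by (simp add: W_def distrib_left)
  finally have "u i r - u j r' \<le> \<delta> - e * (e * c * \<delta>)" by (simp add: \<delta>_def)
  also have "\<dots> = (1 - e\<^sup>2 * c) * \<delta>" by (simp add: algebra_simps power2_eq_square)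
  finally show ?thesis by (simp add: e_def c_def \<delta>_def contraction_def)
qed

end

section \<open>From projections to opinion vectors\<close>

lemma norm_le_if_inner_le:
  fixes v :: "'b::real_inner"
  assumes "v \<bullet> v \<le> C * norm v" "0 \<le> C"
  shows "norm v \<le> C"
  using assms by (cases "v = 0") (auto simp: dot_square_norm power2_eq_square)

text \<open>The bounds on \<open>\<psi>\<close> are required along the trajectory only, since a
  positive continuous function may tend to 0 at infinity.\<close>

locale hk_system =
  fixes \<psi> :: "(real^'d) \<times> (real^'d) \<Rightarrow> real" and \<alpha> :: "real \<Rightarrow> real" and \<tau> K \<kappa> :: real
    and N :: nat and x0 x :: "nat \<Rightarrow> real \<Rightarrow> real^'d"
  assumes N: "2 \<le> N" and tau: "0 < \<tau>" and kappa: "0 \<le> \<kappa>" and K: "0 < K" "\<kappa> \<le> K"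
    and alpha: "0 \<le> t \<Longrightarrow> \<alpha> t \<in> {0..1}" and alpha_cont: "continuous_on {0..} \<alpha>"
    and solution: "hk_solution \<psi> \<alpha> \<tau> N x0 x"
    and rate: "i \<in> {1..N} \<Longrightarrow> j \<in> {1..N} \<Longrightarrow> 0 < t \<Longrightarrow> \<psi> (x i t, x j (t - \<tau>)) \<in> {\<kappa>..K}"
begin

lemma projection:
  "delayed_averaging N \<tau> K \<kappa> \<alpha> (\<lambda>i j t. \<psi> (x i t, x j (t - \<tau>))) (\<lambda>i t. x i t \<bullet> v)"
proof
  fix i t assume i: "i \<in> {1..N}"
  show "continuous_on {-\<tau>..} (\<lambda>t. x i t \<bullet> v)"
    using solution i by (auto simp: hk_solution_def intro!: continuous_on_inner)
  assume t: "(0::real) < t"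
  let ?D = "\<Sum>j\<in>{1..N} - {i}. (\<alpha> t * comm_rate \<psi> \<tau> N x i j t) *\<^sub>R (x j (t - \<tau>) - x i t)"
  have "(x i has_vector_derivative ?D) (at t)" using solution i t by (simp add: hk_solution_def)
  then have "((\<lambda>t. x i t \<bullet> v) has_vector_derivative ?D \<bullet> v) (at t)"
    by (rule bounded_linear.has_vector_derivative[OF bounded_linear_inner_left])
  moreover have "?D \<bullet> v = \<alpha> t * (\<Sum>j\<in>{1..N} - {i}.
      \<psi> (x i t, x j (t - \<tau>)) / (real N - 1) * (x j (t - \<tau>) \<bullet> v - x i t \<bullet> v))"
    by (simp add: inner_sum_left sum_distrib_left comm_rate_def inner_diff_left mult.assoc)
  ultimately show "((\<lambda>t. x i t \<bullet> v) has_real_derivative \<alpha> t * (\<Sum>j\<in>{1..N} - {i}.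
      \<psi> (x i t, x j (t - \<tau>)) / (real N - 1) * (x j (t - \<tau>) \<bullet> v - x i t \<bullet> v))) (at t)"
    by (simp add: has_real_derivative_iff_has_vector_derivative)
next
  show "0 \<le> t \<Longrightarrow> 0 \<le> \<alpha> t" "0 \<le> t \<Longrightarrow> \<alpha> t \<le> 1" for t using alpha[of t] by auto
  fix i j t assume "i \<in> {1..N}" "j \<in> {1..N}" "(0::real) < t"
  from rate[OF this] show "\<kappa> \<le> \<psi> (x i t, x j (t - \<tau>))" "\<psi> (x i t, x j (t - \<tau>)) \<le> K" by auto
qed (rule N tau kappa K alpha_cont)+

lemma norm_le:
  assumes R: "\<And>k s. k \<in> {1..N} \<Longrightarrow> s \<in> {-\<tau>..0} \<Longrightarrow> norm (x k s) \<le> R"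
    and i: "i \<in> {1..N}" and t: "-\<tau> \<le> t"
  shows "norm (x i t) \<le> R"
proof -
  have "x k s \<bullet> x i t \<le> R * norm (x i t)" if "k \<in> {1..N}" "- \<tau> \<le> s" "s \<le> 0" for k s
  proof -
    have "x k s \<bullet> x i t \<le> norm (x k s) * norm (x i t)" by (rule norm_cauchy_schwarz)
    also have "\<dots> \<le> R * norm (x i t)" using R[of k s] that by (intro mult_right_mono) auto
    finally show ?thesis .
  qed
  then have "x i t \<bullet> x i t \<le> R * norm (x i t)"
    using delayed_averaging.upper_bound[OF projection, of 0 "x i t" "R * norm (x i t)" i t] i t by simp
  then have "norm (x i t) * norm (x i t) \<le> R * norm (x i t)"
    by (simp add: dot_square_norm power2_eq_square)
  moreover have "0 \<le> R" using R[OF i, of 0] tau norm_ge_zero[of "x i 0"] by (simp del: norm_ge_zero)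
  ultimately show ?thesis by (cases "x i t = 0") auto
qed

text \<open>The state of a delay equation is a whole segment of length \<open>\<tau>\<close>, hence
  the two independent times.\<close>

definition spread_le :: "real \<Rightarrow> real \<Rightarrow> bool" where
  "spread_le s D \<longleftrightarrow> (\<forall>i\<in>{1..N}. \<forall>j\<in>{1..N}. \<forall>r\<in>{s - \<tau>..s}. \<forall>r'\<in>{s - \<tau>..s}. norm (x i r - x j r') \<le> D)"

lemma spread_nonneg: "spread_le s D \<Longrightarrow> 0 \<le> D"
  using N tau norm_ge_zero[of "x 1 s - x 1 s"] unfolding spread_le_def
  by (elim ballE[of _ _ 1] ballE[of _ _ s]) auto

text \<open>By Cauchy-Schwarz any two projections in the window differ by at most
  \<open>D * norm v\<close>. Comparison with agent 1 at time \<open>s\<close> shows that they form a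
  bounded set, whose supremum and infimum are \<open>M\<close> and \<open>m\<close>.\<close>

lemma projection_bounds:
  assumes "spread_le s D"
  obtains M m where "\<And>k r. k \<in> {1..N} \<Longrightarrow> s - \<tau> \<le> r \<Longrightarrow> r \<le> s \<Longrightarrow> x k r \<bullet> v \<le> M"
    and "\<And>k r. k \<in> {1..N} \<Longrightarrow> s - \<tau> \<le> r \<Longrightarrow> r \<le> s \<Longrightarrow> m \<le> x k r \<bullet> v"
    and "M - m \<le> D * norm v"
proof -
  define S where "S = (\<lambda>(k, r). x k r \<bullet> v) ` ({1..N} \<times> {s - \<tau>..s})"
  have S: "y - z \<le> D * norm v" if "y \<in> S" "z \<in> S" for y z
  proof -
    obtain i j r r' where *: "i \<in> {1..N}" "j \<in> {1..N}" "r \<in> {s - \<tau>..s}" "r' \<in> {s - \<tau>..s}"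
      "y = x i r \<bullet> v" "z = x j r' \<bullet> v"
      using \<open>y \<in> S\<close> \<open>z \<in> S\<close> by (auto simp: S_def)
    have "y - z = (x i r - x j r') \<bullet> v" using * by (simp add: inner_diff_left)
    also have "\<dots> \<le> norm (x i r - x j r') * norm v" by (rule norm_cauchy_schwarz)
    also have "\<dots> \<le> D * norm v"
      using assms * unfolding spread_le_def by (intro mult_right_mono) auto
    finally show ?thesis .
  qed
  have "x 1 s \<bullet> v \<in> S" using N tau by (force simp: S_def)
  then have "S \<noteq> {}" by auto
  have above: "bdd_above S"
    using S[OF _ \<open>x 1 s \<bullet> v \<in> S\<close>] by (intro bdd_aboveI[of _ "x 1 s \<bullet> v + D * norm v"]) force
  have below: "bdd_below S"
    using S[OF \<open>x 1 s \<bullet> v \<in> S\<close>] by (intro bdd_belowI[of _ "x 1 s \<bullet> v - D * norm v"]) force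
  have "Sup S - D * norm v \<le> z" if "z \<in> S" for z
  proof -
    have "Sup S \<le> z + D * norm v"
      using S[OF _ that] by (intro cSup_least[OF \<open>S \<noteq> {}\<close>]) force
    then show ?thesis by simp
  qed
  then have "Sup S - D * norm v \<le> Inf S" by (rule cInf_greatest[OF \<open>S \<noteq> {}\<close>])
  then show ?thesis
    by (intro that[of "Sup S" "Inf S"] cSup_upper[OF _ above] cInf_lower[OF _ below])
      (force simp: S_def)+
qed

lemma spread_persists:
  assumes "0 \<le> s" and D: "spread_le s D" and ij: "i \<in> {1..N}" "j \<in> {1..N}"
    and r: "s - \<tau> \<le> r" "s - \<tau> \<le> r'"
  shows "norm (x i r - x j r') \<le> D"
proof -
  define v where "v = x i r - x j r'"
  obtain M m where M: "\<And>k r. k \<in> {1..N} \<Longrightarrow> s - \<tau> \<le> r \<Longrightarrow> r \<le> s \<Longrightarrow> x k r \<bullet> v \<le> M"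
    and m: "\<And>k r. k \<in> {1..N} \<Longrightarrow> s - \<tau> \<le> r \<Longrightarrow> r \<le> s \<Longrightarrow> m \<le> x k r \<bullet> v"
    and D': "M - m \<le> D * norm v"
    using projection_bounds[OF D] by blast
  have "x i r \<bullet> v \<le> M"
    using delayed_averaging.upper_bound[OF projection \<open>0 \<le> s\<close> M ij(1) r(1)] .
  moreover have "m \<le> x j r' \<bullet> v"
    using delayed_averaging.upper_bound[OF delayed_averaging.neg[OF projection] \<open>0 \<le> s\<close>, of v "- m" j r']
      m ij(2) r(2) by simp
  ultimately have "v \<bullet> v \<le> D * norm v" using D' by (simp add: v_def inner_diff_left)
  then show ?thesis using norm_le_if_inner_le spread_nonneg[OF D] unfolding v_def by blast
qed

text \<open>The factor does not depend on the direction, so \<open>v\<close> may again be the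
  difference to be estimated. \<open>q + \<tau> \<le> t\<close> puts the whole window ending at
  \<open>t\<close> after \<open>q\<close>.\<close>

lemma spread_contracts:
  assumes "0 \<le> s" and D: "spread_le s D" and pq: "s + \<tau> \<le> p" "p \<le> q" "q \<le> s + H"
    and a: "0 < a" "a \<le> integral {p..q} \<alpha>"
    and t: "q + \<tau> \<le> t" "t \<le> s + H"
    and c: "contraction K \<kappa> H a \<le> 1"
  shows "spread_le t ((1 - contraction K \<kappa> H a) * D)"
  unfolding spread_le_def
proof (intro ballI)
  fix i j r r' assume ij: "i \<in> {1..N}" "j \<in> {1..N}" and r: "r \<in> {t - \<tau>..t}" "r' \<in> {t - \<tau>..t}"
  define v where "v = x i r - x j r'"
  obtain M m where M: "\<And>k r. k \<in> {1..N} \<Longrightarrow> s - \<tau> \<le> r \<Longrightarrow> r \<le> s \<Longrightarrow> x k r \<bullet> v \<le> M"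
    and m: "\<And>k r. k \<in> {1..N} \<Longrightarrow> s - \<tau> \<le> r \<Longrightarrow> r \<le> s \<Longrightarrow> m \<le> x k r \<bullet> v"
    and D': "M - m \<le> D * norm v"
    using projection_bounds[OF D] by blast
  have "x i r \<bullet> v - x j r' \<bullet> v \<le> (1 - contraction K \<kappa> H a) * (M - m)"
    using delayed_averaging.spread_contraction[OF projection \<open>0 \<le> s\<close> pq M m a ij, of r r'] r t
    by simp
  also have "\<dots> \<le> (1 - contraction K \<kappa> H a) * (D * norm v)"
    using D' c by (intro mult_left_mono) auto
  finally have "v \<bullet> v \<le> (1 - contraction K \<kappa> H a) * D * norm v"
    by (simp add: v_def inner_diff_left)
  then show "norm (x i r - x j r') \<le> (1 - contraction K \<kappa> H a) * D"
    using norm_le_if_inner_le c spread_nonneg[OF D] unfolding v_def by (metis diff_ge_0_iff_ge mult_nonneg_nonneg)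
qed

end

section \<open>Intervals of the weight sequence\<close>

lemma weight_condition_mono:
  assumes "weight_condition \<alpha> T ts a"
  shows "ts n \<le> ts (Suc n)" and "a \<le> integral {ts n..ts (Suc n)} \<alpha>" and "ts (Suc n) \<le> ts n + T"
proof -
  from assms show a: "a \<le> integral {ts n..ts (Suc n)} \<alpha>" and "ts (Suc n) \<le> ts n + T"
    by (auto simp: weight_condition_def dest!: spec[of _ "Suc n"])
  show "ts n \<le> ts (Suc n)"
  proof (rule ccontr)
    assume "\<not> ts n \<le> ts (Suc n)"
    then have "{ts n..ts (Suc n)} = {}" by simp
    then show False using a assms by (simp add: weight_condition_def)
  qed
qed

text \<open>The least \<open>n\<close> with \<open>y \<le> ts n\<close> is positive because
  \<open>ts 0 = 0 < y\<close>; its predecessor lies below \<open>y\<close>, and two gaps of at most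
  \<open>T\<close> lead from there to \<open>ts (Suc n)\<close>.\<close>

lemma weight_condition_next:
  assumes wc: "weight_condition \<alpha> T ts a" and "0 < y"
  obtains n where "y \<le> ts n" "ts (Suc n) \<le> y + 2 * T"
proof -
  define n where "n = (LEAST n. y \<le> ts n)"
  have "eventually (\<lambda>n. y \<le> ts n) sequentially"
    using wc by (simp add: weight_condition_def filterlim_at_top)
  then have n: "y \<le> ts n" unfolding n_def by (auto intro: LeastI simp: eventually_sequentially)
  have "ts 0 = 0" using wc by (simp add: weight_condition_def)
  then have "n \<noteq> 0" using n \<open>0 < y\<close> by (cases n) auto
  then obtain k where k: "n = Suc k" using not0_implies_Suc by blast
  then have "ts k < y" using not_less_Least[of k "\<lambda>n. y \<le> ts n"] unfolding n_def by simp
  then show ?thesis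
    using that[OF n] weight_condition_mono(3)[OF wc, of k] weight_condition_mono(3)[OF wc, of n] k by simp
qed

lemma le_decay_period:
  assumes wc: "weight_condition \<alpha> T ts a" and "0 < \<tau>"
  shows "\<tau> \<le> decay_period \<tau> T ts"
proof (cases "\<forall>n\<ge>1. \<tau> \<le> ts n - ts (n - 1)")
  case True
  then have "\<tau> \<le> ts (Suc 0) - ts 0" by (metis diff_Suc_1 le_refl One_nat_def)
  moreover have "decay_period \<tau> T ts = T" unfolding decay_period_def if_P[OF True] ..
  ultimately show ?thesis using weight_condition_mono(3)[OF wc, of 0] by linarith
next
  case False
  have "2 * \<tau> \<le> decay_period \<tau> T ts" unfolding decay_period_def if_not_P[OF False] by simp
  then show ?thesis using \<open>0 < \<tau>\<close> by linarith
qed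

text \<open>If all gaps are at least \<open>\<tau>\<close>, then \<open>{ts 1..ts 2}\<close> works,
  as \<open>ts 2 \<le> 2 * T \<le> 3 * T - \<tau>\<close>. Otherwise some interval past
  \<open>\<tau>\<close> ends by \<open>\<tau> + 2 * P\<close> for the decay period \<open>P\<close>,
  and \<open>2 * \<tau> \<le> P\<close>.\<close>

lemma weight_condition_first_interval:
  assumes wc: "weight_condition \<alpha> T ts a" and "0 < \<tau>"
  shows "\<exists>n. \<tau> \<le> ts n \<and> ts (Suc n) \<le> 3 * decay_period \<tau> T ts - \<tau>"
proof (cases "\<forall>n\<ge>1. \<tau> \<le> ts n - ts (n - 1)")
  case True
  then have 1: "\<tau> \<le> ts (Suc 0) - ts 0" by (metis diff_Suc_1 le_refl One_nat_def)
  have "decay_period \<tau> T ts = T" unfolding decay_period_def if_P[OF True] ..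
  moreover have "ts 0 = 0" using wc by (simp add: weight_condition_def)
  moreover note 1 weight_condition_mono(3)[OF wc, of 0] weight_condition_mono(3)[OF wc, of "Suc 0"]
  ultimately have "\<tau> \<le> ts (Suc 0) \<and> ts (Suc (Suc 0)) \<le> 3 * decay_period \<tau> T ts - \<tau>" by linarith
  then show ?thesis ..
next
  case False
  obtain n where "\<tau> \<le> ts n" "ts (Suc n) \<le> \<tau> + 2 * decay_period \<tau> T ts"
    using weight_condition_next[OF weight_condition_decay_period[OF wc] \<open>0 < \<tau>\<close>] by blast
  moreover have "2 * \<tau> \<le> decay_period \<tau> T ts"
    unfolding decay_period_def if_not_P[OF False] by simp
  ultimately have "\<tau> \<le> ts n \<and> ts (Suc n) \<le> 3 * decay_period \<tau> T ts - \<tau>" by linarith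
  then show ?thesis ..
qed

section \<open>Iteration and decay rate\<close>

text \<open>For \<open>n\<close> the integer part of \<open>y / P\<close>, the exponent
  \<open>Suc n\<close> is at least \<open>y / P\<close>, and \<open>ln q\<close> is
  negative.\<close>

lemma power_le_exp:
  fixes q P y :: real
  assumes "0 < q" "q < 1" "0 < P" "0 \<le> y"
  obtains n :: nat where "real n * P \<le> y" "q ^ Suc n \<le> exp (ln q / P * y)"
proof -
  define n where "n = nat \<lfloor>y / P\<rfloor>"
  have n: "real n \<le> y / P" "y / P \<le> real (Suc n)"
    using assms by (auto simp: n_def) linarith
  have "q ^ Suc n = exp (ln q * real (Suc n))"
    using assms by (metis exp_ln exp_of_nat2_mult)
  also have "\<dots> \<le> exp (ln q * (y / P))"
    using n assms by (simp only: exp_le_cancel_iff) (intro mult_left_mono_neg, auto)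
  finally show ?thesis using that[of n] n assms by (simp add: field_simps)
qed

lemma (in hk_system) exponential_decay:
  assumes wc: "weight_condition \<alpha> T ts a" and kappa_pos: "0 < \<kappa>"
    and S: "S = 3 * decay_period \<tau> T ts - \<tau>" and H: "H = S + 2 * \<tau>"
    and D: "spread_le 0 D" and t: "0 \<le> t" and ij: "i \<in> {1..N}" "j \<in> {1..N}"
  shows "norm (x i t - x j t) \<le> D * exp (ln (1 - contraction K \<kappa> H a) / H * (t - S))"
proof -
  define P where "P = decay_period \<tau> T ts"
  have P: "\<tau> \<le> P" using le_decay_period[OF wc tau] by (simp add: P_def)
  have wcP: "weight_condition \<alpha> P ts a" using weight_condition_decay_period[OF wc] by (simp add: P_def)
  have a: "0 < a" using wc by (simp add: weight_condition_def)
  have SH: "S = 3 * P - \<tau>" "H = 3 * P + \<tau>" by (simp_all add: S H P_def)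
  have H0: "0 < H" using SH P tau by simp
  have c: "0 < contraction K \<kappa> H a" "contraction K \<kappa> H a < 1"
    using contraction_bounds kappa_pos K(2) H0 a by auto
  \<comment> \<open>The window ending at \<open>3 * P + n * H\<close> starts at
    \<open>S + n * H\<close>, so the power \<open>Suc n\<close> is available from there on. The
    first contraction uses an interval ending by \<open>S\<close>; each later one fits because
    \<open>\<tau> + 2 * P + \<tau> \<le> H\<close>, by \<open>\<tau> \<le> P\<close>.\<close>
  have iter: "spread_le (3 * P + real n * H) ((1 - contraction K \<kappa> H a) ^ Suc n * D)" for n
  proof (induction n)
    case 0
    obtain k where "\<tau> \<le> ts k" "ts (Suc k) \<le> S"
      using weight_condition_first_interval[OF wc tau] S by blast
    then have "spread_le (3 * P) ((1 - contraction K \<kappa> H a) * D)"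
      using c tau P SH
      by (intro spread_contracts[OF order_refl D _ weight_condition_mono(1)[OF wc, of k] _ a
        weight_condition_mono(2)[OF wc, of k]]) auto
    then show ?case by simp
  next
    case (Suc n)
    let ?s = "3 * P + real n * H"
    have s: "0 \<le> ?s" using P tau H0 by simp
    then obtain k where "?s + \<tau> \<le> ts k" "ts (Suc k) \<le> ?s + \<tau> + 2 * P"
      using weight_condition_next[OF wcP, of "?s + \<tau>"] tau by auto
    then have "spread_le (?s + H) ((1 - contraction K \<kappa> H a) * ((1 - contraction K \<kappa> H a) ^ Suc n * D))"
      using c tau P SH
      by (intro spread_contracts[OF s Suc _ weight_condition_mono(1)[OF wc, of k] _ a
        weight_condition_mono(2)[OF wc, of k]]) auto
    then show ?case by (simp add: algebra_simps)
  qed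
  have D0: "0 \<le> D" using spread_nonneg[OF D] .
  show "norm (x i t - x j t) \<le> D * exp (ln (1 - contraction K \<kappa> H a) / H * (t - S))"
  proof (cases "S \<le> t")
    case True
    obtain n where n: "real n * H \<le> t - S"
      "(1 - contraction K \<kappa> H a) ^ Suc n \<le> exp (ln (1 - contraction K \<kappa> H a) / H * (t - S))"
      using power_le_exp[of "1 - contraction K \<kappa> H a" H "t - S"] c H0 True by auto
    have "norm (x i t - x j t) \<le> (1 - contraction K \<kappa> H a) ^ Suc n * D"
      using n(1) SH P tau H0 by (intro spread_persists[OF _ iter ij]) auto
    also have "\<dots> \<le> exp (ln (1 - contraction K \<kappa> H a) / H * (t - S)) * D"
      using n(2) D0 by (rule mult_right_mono)
    finally show ?thesis by (simp add: mult.commute)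
  next
    case False
    \<comment> \<open>Before \<open>S\<close> the exponential factor is at least 1, so persistence
      of the spread suffices.\<close>
    have "norm (x i t - x j t) \<le> D" using t tau by (intro spread_persists[OF _ D ij]) auto
    moreover have "0 \<le> ln (1 - contraction K \<kappa> H a) / H * (t - S)"
      using False c H0 by (intro mult_nonpos_nonpos divide_nonpos_pos) auto
    then have "D * 1 \<le> D * exp (ln (1 - contraction K \<kappa> H a) / H * (t - S))"
      using D0 by (intro mult_left_mono) auto
    ultimately show ?thesis by simp
  qed
qed

text \<open>The rate is fixed by \<open>K\<close>, \<open>\<kappa>\<close>, \<open>H\<close> and
  \<open>a\<close> before \<open>N\<close> and the solution are chosen; the initial data enter it
  only through \<open>R\<close>, which determines \<open>\<kappa>\<close>.\<close>

theorem theorem3p1: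
  fixes \<psi> :: "(real^'d) \<times> (real^'d) \<Rightarrow> real"
    and \<alpha> :: "real \<Rightarrow> real"
    and \<tau> T a :: real
    and ts :: "nat \<Rightarrow> real"
  assumes "0 < \<tau>"
    and "\<forall>p. 0 < \<psi> p" and "bounded (range \<psi>)" and "continuous_on UNIV \<psi>"
    and "continuous_on {0..} \<alpha>" and "\<forall>t\<ge>0. \<alpha> t \<in> {0..1}"
    and "weight_condition \<alpha> T ts a"
  shows "\<forall>R. \<exists>\<gamma>>0. \<forall>N\<ge>2. \<forall>x0 x.
    (\<forall>i\<in>{1..N}. continuous_on {-\<tau>..0} (x0 i)) \<longrightarrow>
    (\<forall>i\<in>{1..N}. \<forall>s\<in>{-\<tau>..0}. norm (x0 i s) \<le> R) \<longrightarrow>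
    hk_solution \<psi> \<alpha> \<tau> N x0 x \<longrightarrow>
    (\<forall>t\<ge>0. opinion_diameter N x t \<le>
       initial_diameter \<tau> N x * exp (- \<gamma> * (t - 3 * decay_period \<tau> T ts + \<tau>)))"
proof
  fix R :: real
  obtain K where K: "\<psi> p \<le> K" for p
    using \<open>bounded (range \<psi>)\<close> unfolding bounded_iff by (force simp: abs_le_iff)
  \<comment> \<open>The absolute value keeps \<open>B\<close> nonempty for negative
    \<open>R\<close>, so that \<open>\<psi>\<close> attains a minimum on \<open>B\<close>; being a
    value of \<open>\<psi>\<close>, it is positive.\<close>
  define B where "B = (cball 0 \<bar>R\<bar> :: (real^'d) set) \<times> (cball 0 \<bar>R\<bar> :: (real^'d) set)"
  have "compact B" "B \<noteq> {}" by (auto simp: B_def compact_Times)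
  then obtain p where p: "\<And>y. y \<in> B \<Longrightarrow> \<psi> p \<le> \<psi> y"
    using continuous_attains_inf[of B \<psi>] continuous_on_subset[OF assms(4)] by blast
  define \<kappa> where "\<kappa> = \<psi> p"
  have \<kappa>: "0 < \<kappa>" "\<kappa> \<le> K" using assms(2)[rule_format, of p] K[of p] by (simp_all only: \<kappa>_def)
  define S where "S = 3 * decay_period \<tau> T ts - \<tau>"
  define H where "H = S + 2 * \<tau>"
  define c where "c = contraction K \<kappa> H a"
  have "0 < H" using le_decay_period[OF assms(7,1)] assms(1) by (simp add: H_def S_def)
  have "0 < a" using assms(7) by (simp add: weight_condition_def)
  have c: "0 < c" "c < 1" using contraction_bounds \<kappa> \<open>0 < H\<close> \<open>0 < a\<close> by (auto simp: c_def)
  have estimate: "opinion_diameter N x t \<le> initial_diameter \<tau> N x * exp (ln (1 - c) / H * (t - S))"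
    if N: "2 \<le> N" and R: "\<forall>i\<in>{1..N}. \<forall>s\<in>{-\<tau>..0}. norm (x0 i s) \<le> R"
      and sol: "hk_solution \<psi> \<alpha> \<tau> N x0 x" and t: "0 \<le> t" for N x0 x t
  proof -
    have init: "norm (x i s) \<le> R" if "i \<in> {1..N}" "s \<in> {-\<tau>..0}" for i s
      using sol R that by (auto simp: hk_solution_def)
    \<comment> \<open>The positive lower bound on \<open>\<psi>\<close> is only available once the opinions are known to stay in
      the ball; that follows already with the trivial lower bound 0.\<close>
    interpret crude: hk_system \<psi> \<alpha> \<tau> K 0 N x0 x
    proof
      show "\<psi> (x i s, x j (s - \<tau>)) \<in> {0..K}" for i j s
        using K less_imp_le[OF assms(2)[rule_format]] by (intro atLeastAtMost_iff[THEN iffD2] conjI)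
      show "0 < K" using \<kappa> by linarith
      then show "0 \<le> K" by linarith
    qed (rule N sol assms(1,5) order_refl assms(6)[rule_format] | assumption)+
    interpret hk_system \<psi> \<alpha> \<tau> K \<kappa> N x0 x
    proof
      fix i j s assume *: "i \<in> {1..N}" "j \<in> {1..N}" "(0::real) < s"
      have "norm (x i s) \<le> R" "norm (x j (s - \<tau>)) \<le> R"
        using * assms(1) by (auto intro!: crude.norm_le[OF init])
      then have "(x i s, x j (s - \<tau>)) \<in> B" by (auto simp: B_def)
      then show "\<psi> (x i s, x j (s - \<tau>)) \<in> {\<kappa>..K}" unfolding \<kappa>_def atLeastAtMost_iff using p K by blast
    qed (rule N sol assms(1,5) less_imp_le[OF \<kappa>(1)] \<kappa>(2) crude.K assms(6)[rule_format] | assumption)+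
    have "spread_le 0 (initial_diameter \<tau> N x)"
      unfolding spread_le_def
    proof (intro ballI)
      fix i j r r' assume ij: "i \<in> {1..N}" "j \<in> {1..N}" and r: "r \<in> {0 - \<tau>..0}" "r' \<in> {0 - \<tau>..0}"
      let ?f = "\<lambda>(r, s). norm (x i r - x j s)"
      \<comment> \<open>Boundedness is what makes the supremum an upper bound of its set.\<close>
      have "?f y \<le> 2 * R" if "y \<in> {-\<tau>..0} \<times> {-\<tau>..0}" for y
        using that init[OF ij(1), of "fst y"] init[OF ij(2), of "snd y"]
          norm_triangle_ineq4[of "x i (fst y)" "x j (snd y)"] by (auto simp: case_prod_beta)
      then have "bdd_above (?f ` ({-\<tau>..0} \<times> {-\<tau>..0}))" by (intro bdd_aboveI2)
      then have "norm (x i r - x j r') \<le> (SUP (r, s) \<in> {-\<tau>..0} \<times> {-\<tau>..0}. norm (x i r - x j s))"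
        using r by (intro cSUP_upper2[of ?f _ "(r, r')"]) auto
      also have "\<dots> \<le> initial_diameter \<tau> N x"
        unfolding initial_diameter_def using ij by (intro Max_ge) force+
      finally show "norm (x i r - x j r') \<le> initial_diameter \<tau> N x" .
    qed
    then have "norm (x i t - x j t) \<le> initial_diameter \<tau> N x * exp (ln (1 - c) / H * (t - S))"
      if "i \<in> {1..N}" "j \<in> {1..N}" for i j
      using exponential_decay[OF assms(7) \<kappa>(1) S_def H_def _ t that] by (simp add: c_def)
    then show ?thesis
      unfolding opinion_diameter_def using N by (intro Max.boundedI) auto
  qed
  show "\<exists>\<gamma>>0. \<forall>N\<ge>2. \<forall>x0 x.
    (\<forall>i\<in>{1..N}. continuous_on {-\<tau>..0} (x0 i)) \<longrightarrow>
    (\<forall>i\<in>{1..N}. \<forall>s\<in>{-\<tau>..0}. norm (x0 i s) \<le> R) \<longrightarrow>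
    hk_solution \<psi> \<alpha> \<tau> N x0 x \<longrightarrow>
    (\<forall>t\<ge>0. opinion_diameter N x t \<le>
       initial_diameter \<tau> N x * exp (- \<gamma> * (t - 3 * decay_period \<tau> T ts + \<tau>)))"
  proof (intro exI[of _ "- ln (1 - c) / H"] conjI allI impI)
    show "0 < - ln (1 - c) / H" using c \<open>0 < H\<close> by (intro divide_pos_pos) auto
    fix N x0 x t
    assume "2 \<le> N" "\<forall>i\<in>{1..N}. \<forall>s\<in>{-\<tau>..0}. norm (x0 i s) \<le> R"
      "hk_solution \<psi> \<alpha> \<tau> N x0 x" "(0::real) \<le> t"
    then have "opinion_diameter N x t \<le> initial_diameter \<tau> N x * exp (ln (1 - c) / H * (t - S))"
      by (rule estimate)
    moreover have "t - S = t - 3 * decay_period \<tau> T ts + \<tau>" by (simp add: S_def)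
    ultimately show "opinion_diameter N x t \<le>
       initial_diameter \<tau> N x * exp (- (- ln (1 - c) / H) * (t - 3 * decay_period \<tau> T ts + \<tau>))"
      by simp
  qed
qed

end
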